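(* Let $F$ be a field of characteristic different from $2$, let $(A,\sigma)$ be an $F$-algebra with involution and let $\mathcal{P}$ be a prepositive cone on $(A,\sigma)$. (1) Assume that $1\in\mathcal{P}$. Then $\mathcal{P}_F=\mathcal{P}\cap F$. (2) Let $\alpha\in\mathcal{P}_F\setminus\{0\}$. Then $\alpha\mathcal{P}=\mathcal{P}$.
   Context: An ordering on $F$ is a subset $P\subseteq F$ with $P+P\subseteq P$, $P\cdot P\subseteq P$, $P\cup -P=F$ and $P\cap -P=\{0\}$ (so $0\in P$). An $F$-algebra with involution is a pair $(A,\sigma)$ where $A$ is a finite-dimensional simple $F$-algebra whose centre $K=Z(A)$ is a field and $\sigma:A\to A$ is an involution (additive, $\sigma(xy)=\sigma(y)\sigma(x)$, $\sigma^2=\mathrm{id}$) such that $F=K\cap \mathrm{Sym}(A,\sigma)$, where $\mathrm{Sym}(A,\sigma)=\{a\in A\mid \sigma(a)=a\}$. A prepositive cone on $(A,\sigma)$ is a subset $\mathcal{P}\subseteq \mathrm{Sym}(A,\sigma)$ such that (P1) $\mathcal{P}\neq\varnothing$; (P2) $\mathcal{P}+\mathcal{P}\subseteq\mathcal{P}$; (P3) $\sigma(a)\cdot\mathcal{P}\cdot a\subseteq\mathcal{P}$ for every $a\in A$; (P4) $\mathcal{P}_F:=\{u\in F\mid u\mathcal{P}\subseteq\mathcal{P}\}$ is an ordering on $F$; (P5) $\mathcal{P}\cap-\mathcal{P}=\{0\}$. *)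

theory Defs
  imports Complex_Main
begin

definition is_ordering :: "'f::field set \<Rightarrow> bool" where
  "is_ordering P \<longleftrightarrow>
     (\<forall>x\<in>P. \<forall>y\<in>P. x + y \<in> P) \<and>
     (\<forall>x\<in>P. \<forall>y\<in>P. x * y \<in> P) \<and>
     P \<union> uminus ` P = UNIV \<and>
     P \<inter> uminus ` P = {0}"

definition centre :: "'a::ring_1 set" where
  "centre = {z. \<forall>a. z * a = a * z}"

definition two_sided_ideal :: "'a::ring_1 set \<Rightarrow> bool" where
  "two_sided_ideal I \<longleftrightarrow>
     0 \<in> I \<and> (\<forall>x\<in>I. \<forall>y\<in>I. x + y \<in> I) \<and> (\<forall>a. \<forall>x\<in>I. a * x \<in> I \<and> x * a \<in> I)"

definition Sym :: "('a \<Rightarrow> 'a) \<Rightarrow> 'a set" where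
  "Sym \<sigma> = {a. \<sigma> a = a}"

text \<open>
  The field \<open>F\<close> is the type \<open>'f\<close>, acting on \<open>A\<close> (the type \<open>'a\<close>, nonzero by its class) through
  \<open>scale\<close>. It is identified with the subset \<open>F_in scale\<close> of \<open>A\<close> along the injective map
  \<open>u \<mapsto> u \<cdot> 1\<close>.
\<close>

definition F_in :: "('f::field \<Rightarrow> 'a::ring_1 \<Rightarrow> 'a) \<Rightarrow> 'a set" where
  "F_in scale = range (\<lambda>u. scale u 1)"

text \<open>
  The involution is only assumed to be additive; its \<open>F\<close>-linearity follows from
  \<open>F_eq\<close>, since it fixes the central elements \<open>u \<cdot> 1\<close>.
\<close>

locale algebra_with_involution = vector_space scale
  for scale :: "'f::field \<Rightarrow> 'a::ring_1 \<Rightarrow> 'a" +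
  fixes \<sigma> :: "'a \<Rightarrow> 'a"
  assumes scale_mult_left: "scale u x * y = scale u (x * y)"
    and scale_mult_right: "x * scale u y = scale u (x * y)"
    and finite_dim: "\<exists>B. finite_dimensional_vector_space scale B"
    and simple: "two_sided_ideal (I :: 'a set) \<Longrightarrow> I = {0} \<or> I = UNIV"
    and centre_field: "(z :: 'a) \<in> centre \<Longrightarrow> z \<noteq> 0 \<Longrightarrow> \<exists>w\<in>centre. z * w = 1"
    and sigma_add: "\<sigma> (x + y) = \<sigma> x + \<sigma> y"
    and sigma_mult: "\<sigma> (x * y) = \<sigma> y * \<sigma> x"
    and sigma_sigma: "\<sigma> (\<sigma> x) = x"
    and F_eq: "F_in scale = centre \<inter> Sym \<sigma>"

definition cone_F :: "('f::field \<Rightarrow> 'a::ring_1 \<Rightarrow> 'a) \<Rightarrow> 'a set \<Rightarrow> 'f set" where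
  "cone_F scale P = {u. scale u ` P \<subseteq> P}"

definition prepositive_cone ::
  "('f::field \<Rightarrow> 'a::ring_1 \<Rightarrow> 'a) \<Rightarrow> ('a \<Rightarrow> 'a) \<Rightarrow> 'a set \<Rightarrow> bool" where
  "prepositive_cone scale \<sigma> P \<longleftrightarrow>
     P \<subseteq> Sym \<sigma> \<and>
     P \<noteq> {} \<and>
     (\<forall>x\<in>P. \<forall>y\<in>P. x + y \<in> P) \<and>
     (\<forall>a. \<forall>x\<in>P. \<sigma> a * x * a \<in> P) \<and>
     is_ordering (cone_F scale P) \<and>
     P \<inter> uminus ` P = {0}"

end

theory Submission
  imports Defs
begin

text \<open>Both parts rest on \<open>cone_F scale P\<close> being an ordering of the field. For
  (1), if u lies in it, then applying u to 1 gives u * 1 in \<open>P\<close>. Conversely, let u * 1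
  lie in \<open>P\<close>. If u is not in the ordering, then -u is, so -(u * 1) is also in
  \<open>P\<close>; properness of \<open>P\<close> forces u = 0, which is in the ordering after all.
  For (2), an ordering contains the inverses of its nonzero elements
  (\<open>is_ordering_inverse\<close>), so both \<alpha> and its inverse map \<open>P\<close> into
  itself, and scaling by \<alpha> is onto \<open>P\<close>.\<close>

lemma is_ordering_cases:
  assumes "is_ordering Q"
  obtains "u \<in> Q" | "- u \<in> Q"
proof -
  have "u \<in> Q \<union> uminus ` Q"
    using assms unfolding is_ordering_def by blast
  with that show thesis by auto
qed

text \<open>Otherwise the negated inverse lies in \<open>Q\<close>; times u it gives -1, whose
  square is 1, so 1 and -1 both lie in \<open>Q\<close>, against \<open>Q\<close> meeting its
  negative only in 0.\<close>

lemma is_ordering_inverse: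
  fixes Q :: "'f::field set"
  assumes Q: "is_ordering Q" and "u \<in> Q" and "u \<noteq> 0"
  shows "inverse u \<in> Q"
  using Q
proof (cases rule: is_ordering_cases[where u = "inverse u"])
  \<comment> \<open>Case 1 is the goal itself and is left to the closing \<open>qed\<close>.\<close>
  case 2
  have mult: "x * y \<in> Q" if "x \<in> Q" "y \<in> Q" for x y
    using Q that unfolding is_ordering_def by blast
  have m1: "- 1 \<in> Q"
    using mult[OF \<open>u \<in> Q\<close> 2] \<open>u \<noteq> 0\<close> by simp
  from mult[OF this this] have "1 \<in> Q" by simp
  with m1 have "1 \<in> Q \<inter> uminus ` Q"
    by (metis IntI add.inverse_inverse imageI)
  then have "(1 :: 'f) \<in> {0}"
    using Q unfolding is_ordering_def by blast
  then show ?thesis by simp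
qed

theorem proposition3p9:
  fixes scale :: "'f::field \<Rightarrow> 'a::ring_1 \<Rightarrow> 'a"
    and \<sigma> :: "'a \<Rightarrow> 'a"
    and P :: "'a set"
  assumes char: "CHAR('f) \<noteq> 2"
    and alg: "algebra_with_involution scale \<sigma>"
    and cone: "prepositive_cone scale \<sigma> P"
  shows "(1 \<in> P \<longrightarrow> (\<lambda>u. scale u 1) ` cone_F scale P = P \<inter> F_in scale) \<and>
         (\<forall>\<alpha> \<in> cone_F scale P - {0}. scale \<alpha> ` P = P)"
proof -
  interpret algebra_with_involution scale \<sigma> by (fact alg)
  have ord: "is_ordering (cone_F scale P)" and proper: "P \<inter> uminus ` P = {0}"
    using cone by (simp_all add: prepositive_cone_def)
  have scale_mem: "scale u x \<in> P" if "u \<in> cone_F scale P" "x \<in> P" for u x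
    using that unfolding cone_F_def by blast
  have cone_F_iff: "u \<in> cone_F scale P \<longleftrightarrow> scale u 1 \<in> P" if one: "1 \<in> P" for u
  proof
    assume u: "scale u 1 \<in> P"
    show "u \<in> cone_F scale P"
      using ord
    proof (cases rule: is_ordering_cases[where u = u])
      case 2
      from scale_mem[OF this one] have "- scale u 1 \<in> P" by simp
      then have "scale u 1 \<in> P \<inter> uminus ` P"
        using u by (metis IntI add.inverse_inverse imageI)
      \<comment> \<open>Properness gives \<open>scale u 1 = 0\<close>, and 1 is nonzero in the
        algebra.\<close>
      then have "u = 0" using proper by simp
      with 2 show ?thesis by simp
    qed
  qed (rule scale_mem[OF _ one])
  have "scale \<alpha> ` P = P" if "\<alpha> \<in> cone_F scale P" "\<alpha> \<noteq> 0" for \<alpha>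
  proof
    show "scale \<alpha> ` P \<subseteq> P" using that(1) scale_mem by blast
    show "P \<subseteq> scale \<alpha> ` P"
    proof
      fix x assume "x \<in> P"
      then have "scale (inverse \<alpha>) x \<in> P"
        using scale_mem is_ordering_inverse[OF ord that] by blast
      moreover have "x = scale \<alpha> (scale (inverse \<alpha>) x)"
        using that(2) by simp
      ultimately show "x \<in> scale \<alpha> ` P" by blast
    qed
  qed
  then show ?thesis
    \<comment> \<open>Every element of \<open>F_in scale\<close> has the form
      \<open>scale u 1\<close>, so the equivalence for each u yields the equality of sets.\<close>
    using cone_F_iff unfolding F_in_def by blast
qed

end
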